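(* Let $m,n$ be positive integers with $mn$ even. If there are triangle designs in $\mathbb{F}_2^m$ and in $\mathbb{F}_2^n$, then there is a triangle design in $\mathbb{F}_2^{m+n}$.
   Context: For a vector space $V$ over $\mathbb{F}_2$, a triangle is a set $\{\langle a,b\rangle,\langle b,c\rangle,\langle c,a\rangle\}$ of three $2$-dimensional subspaces, with $a,b,c$ linearly independent. A triangle design in $V$ is a set of triangles such that every $2$-dimensional subspace of $V$ belongs to exactly one triangle of the set (for $\dim V=1$ the empty set is a triangle design). *)

theory Defs
  imports Complex_Main "HOL-Library.Z2" "HOL-Library.Function_Algebras"
begin

text \<open>Vector spaces are given as subspaces \<open>V\<close> of an ambient vector space over
  the two-element field \<^typ>\<open>bit\<close>.\<close>

locale f2_vector_space = vector_space scale
  for scale :: "bit \<Rightarrow> 'v::ab_group_add \<Rightarrow> 'v"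
begin

definition two_dim_subspaces :: "'v set \<Rightarrow> 'v set set" where
  "two_dim_subspaces V = {W. subspace W \<and> W \<subseteq> V \<and> dim W = 2}"

text \<open>As \<open>independent\<close> is a predicate on sets, linear independence of the family
  \<open>a, b, c\<close> also needs the three vectors to be distinct.\<close>

definition is_triangle :: "'v set \<Rightarrow> 'v set set \<Rightarrow> bool" where
  "is_triangle V t \<longleftrightarrow>
     (\<exists>a\<in>V. \<exists>b\<in>V. \<exists>c\<in>V. distinct [a, b, c] \<and> independent {a, b, c} \<and>
        t = {span {a, b}, span {b, c}, span {c, a}})"

definition is_triangle_design :: "'v set \<Rightarrow> 'v set set set \<Rightarrow> bool" where
  "is_triangle_design V D \<longleftrightarrow>
     (\<forall>t\<in>D. is_triangle V t) \<and> (\<forall>W\<in>two_dim_subspaces V. \<exists>!t. t \<in> D \<and> W \<in> t)"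

end

definition f2_scale :: "bit \<Rightarrow> (nat \<Rightarrow> bit) \<Rightarrow> (nat \<Rightarrow> bit)" where
  "f2_scale c x = (\<lambda>i. c * x i)"

global_interpretation f2: f2_vector_space f2_scale
  by unfold_locales (auto simp: f2_scale_def fun_eq_iff algebra_simps)

text \<open>The coordinate space of dimension \<open>n\<close>: the coordinates are those with index
  below \<open>n\<close>, and all others are zero.\<close>

definition F2_space :: "nat \<Rightarrow> (nat \<Rightarrow> bit) set" where
  "F2_space n = {x. \<forall>i\<ge>n. x i = 0}"

lemma subspace_F2_space: "f2.subspace (F2_space n)"
  by (auto simp: f2.subspace_def F2_space_def f2_scale_def)

lemma dim_F2_space: "f2.dim (F2_space n) = n"
proof -
  define e :: "nat \<Rightarrow> nat \<Rightarrow> bit" where "e i = (\<lambda>j. if j = i then 1 else 0)" for i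
  have inj: "inj_on e A" for A
    by (rule inj_onI) (metis e_def zero_neq_one)
  have ev: "(\<Sum>i\<in>A. f2_scale (u i) (e i)) j = (if j \<in> A then u j else 0)"
    if "finite A" for A u j
    using that by (induction A) (auto simp: f2_scale_def e_def)
  have indep: "f2.independent (e ` {..<n})"
    unfolding f2.dependent_finite[OF finite_imageI[OF finite_lessThan]]
  proof
    assume "\<exists>u. (\<exists>v\<in>e ` {..<n}. u v \<noteq> 0) \<and> (\<Sum>v\<in>e ` {..<n}. f2_scale (u v) v) = 0"
    then obtain u i where i: "i \<in> {..<n}" "u (e i) \<noteq> 0"
      and "(\<Sum>v\<in>e ` {..<n}. f2_scale (u v) v) = 0"
      by blast
    then have "(\<Sum>i<n. f2_scale ((u \<circ> e) i) (e i)) = 0"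
      by (simp add: sum.reindex[OF inj] del: bit_not_zero_iff)
    then show False
      using ev[of "{..<n}" "u \<circ> e" i] i by (simp del: bit_not_zero_iff)
  qed
  have "F2_space n \<subseteq> f2.span (e ` {..<n})"
  proof
    fix x assume "x \<in> F2_space n"
    then have "x = (\<Sum>i<n. f2_scale (x i) (e i))"
      by (auto simp: F2_space_def ev)
    also have "\<dots> \<in> f2.span (e ` {..<n})"
      by (intro f2.span_sum f2.span_scale f2.span_base) auto
    finally show "x \<in> f2.span (e ` {..<n})" .
  qed
  moreover have "e ` {..<n} \<subseteq> F2_space n"
    by (auto simp: e_def F2_space_def)
  ultimately show ?thesis
    using f2.dim_unique[OF _ _ indep, of "F2_space n" n] by (simp add: card_image[OF inj])
qed

end

theory Submission
  imports Defs
begin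

text \<open>Split the space as a direct sum of \<open>A\<close> and \<open>B\<close> with \<open>dim A\<close> even, so that \<open>A\<close> has a
  line spread (the orbits of a fixed-point-free linear map of order three). Lines inside \<open>A\<close> and
  inside \<open>B\<close> are covered by the given designs. For a line \<open>\<langle>a, c\<rangle>\<close> of \<open>A\<close> and \<open>b\<close> in \<open>B\<close>, the
  plane \<open>\<langle>a, c, b\<rangle>\<close> contains three lines that avoid \<open>b\<close> and differ from \<open>\<langle>a, c\<rangle>\<close>; they form the
  triangle with vertices \<open>a + b, c + b, a + c + b\<close>. The same works with \<open>A\<close> and \<open>B\<close> exchanged.
  When \<open>\<langle>a, c\<rangle>\<close> is in the spread, one covers at once these three lines and the three lines
  through \<open>b\<close>, by two triangles, and in this way every line \<open>\<langle>a, b\<rangle>\<close> is covered once. The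
  remaining lines are the graphs of isomorphisms from a line of \<open>A\<close> to a line of \<open>B\<close>: if \<open>x, y, z\<close>
  are the vertices of a triangle of the design of \<open>A\<close>, an isomorphism from a side of the triangle
  onto \<open>\<langle>b, d\<rangle>\<close> extends uniquely to a bijection from the vertices to the three nonzero vectors of
  \<open>\<langle>b, d\<rangle>\<close>, so the triangles with vertices \<open>x + b, y + d, z + b + d\<close> cover these lines.\<close>

section \<open>Lines and triangles over F_2 in terms of explicit vectors\<close>

context f2_vector_space
begin

lemma add_self [simp]: "v + v = 0" for v :: 'v
proof -
  have "scale (1 + 1) v = scale 1 v + scale 1 v"
    by (rule scale_left_distrib)
  then show ?thesis by simp
qed

lemma add_self_left [simp]: "v + (v + w) = w" for v w :: 'v
  by (metis add.assoc add_0 add_self)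

lemma add_eq_0 [simp]: "v + w = 0 \<longleftrightarrow> v = w" for v w :: 'v
  by (metis add_self add_left_cancel)

lemma diff_eq_add: "v - w = v + w" for v w :: 'v
  by (metis add_eq_0 diff_add_cancel add_self_left add.commute)

lemma f2_subspaceI: "0 \<in> S \<Longrightarrow> (\<And>x y. x \<in> S \<Longrightarrow> y \<in> S \<Longrightarrow> x + y \<in> S) \<Longrightarrow> subspace S"
proof -
  assume S: "0 \<in> S" "\<And>x y. x \<in> S \<Longrightarrow> y \<in> S \<Longrightarrow> x + y \<in> S"
  have "scale c x \<in> S" if "x \<in> S" for c x
    using S(1) that by (cases c) auto
  then show ?thesis
    using S by (simp add: subspace_def)
qed

text \<open>A line is written out as a finite set, so that identities between lines reduce to
  rearranging sums. For dependent arguments the set shrinks to one or two elements.\<close>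

definition line :: "'v \<Rightarrow> 'v \<Rightarrow> 'v set" where
  "line a b = {0, a, b, a + b}"

definition indep2 :: "'v \<Rightarrow> 'v \<Rightarrow> bool" where
  "indep2 a b \<longleftrightarrow> a \<noteq> 0 \<and> b \<noteq> 0 \<and> a \<noteq> b"

definition indep3 :: "'v \<Rightarrow> 'v \<Rightarrow> 'v \<Rightarrow> bool" where
  "indep3 a b c \<longleftrightarrow> indep2 a b \<and> c \<notin> line a b"

definition tri :: "'v \<Rightarrow> 'v \<Rightarrow> 'v \<Rightarrow> 'v set set" where
  "tri a b c = {line a b, line b c, line c a}"

definition lines :: "'v set \<Rightarrow> 'v set set" where
  "lines V = {line a b |a b. a \<in> V \<and> b \<in> V \<and> indep2 a b}"

lemma span_one: "span {b} = {0, b}"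
proof -
  have "x = scale k b \<Longrightarrow> x = 0 \<or> x = b" for x k
    by (cases k) auto
  then show ?thesis
    by (auto simp: span_singleton intro: rev_image_eqI[of 0] rev_image_eqI[of 1])
qed

lemma ex_bit: "(\<exists>k::bit. P k) \<longleftrightarrow> P 0 \<or> P 1"
  by (metis bit_not_zero_iff)

lemma span_two: "span {a, b} = line a b"
proof -
  have "x + a = b \<longleftrightarrow> x = a + b" "x + a = 0 \<longleftrightarrow> x = a" for x
    by (metis add.commute add_self_left) simp
  then show ?thesis
    unfolding span_insert[of a "{b}"] span_one line_def
    by (auto simp: ex_bit diff_eq_add)
qed

lemma independent_two: "a \<noteq> b \<Longrightarrow> independent {a, b} \<longleftrightarrow> indep2 a b"
  by (auto simp: independent_insert span_one indep2_def)

lemma independent_three: "distinct [a, b, c] \<and> independent {a, b, c} \<longleftrightarrow> indep3 a b c"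
proof -
  have "independent {a, b, c} \<longleftrightarrow> c \<notin> span {a, b} \<and> independent {a, b}" if "distinct [a, b, c]"
    using that independent_insert[of c "{a, b}"] by (auto simp: insert_commute)
  then show ?thesis
    using independent_two[of a b] by (auto simp: span_two indep3_def indep2_def line_def)
qed

lemma two_dim_subspaces_eq_lines:
  assumes "subspace V"
  shows "two_dim_subspaces V = lines V"
proof (intro equalityI subsetI)
  fix W assume "W \<in> two_dim_subspaces V"
  then have W: "subspace W" "W \<subseteq> V" "dim W = 2"
    by (auto simp: two_dim_subspaces_def)
  obtain S where S: "S \<subseteq> W" "independent S" "W \<subseteq> span S" "card S = 2"
    using basis_exists[of W] W(3) by auto
  obtain a b where ab: "S = {a, b}" "a \<noteq> b"
    using S(4) by (auto simp: card_2_iff)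
  have "W = line a b"
    using S ab W(1) span_minimal[of S W] span_two by auto
  then show "W \<in> lines V"
    using S ab W(2) independent_two by (auto simp: lines_def)
next
  fix W assume "W \<in> lines V"
  then obtain a b where ab: "a \<in> V" "b \<in> V" "indep2 a b" "W = line a b"
    by (auto simp: lines_def)
  then have "dim W = card {a, b}" "subspace W" "W \<subseteq> V"
    using dim_span_eq_card_independent[of "{a, b}"] independent_two[of a b] span_minimal[of "{a, b}" V] assms
    by (auto simp: span_two[symmetric] indep2_def)
  then show "W \<in> two_dim_subspaces V"
    using ab by (auto simp: two_dim_subspaces_def indep2_def)
qed

lemma is_triangle_iff: "is_triangle V t \<longleftrightarrow> (\<exists>a\<in>V. \<exists>b\<in>V. \<exists>c\<in>V. indep3 a b c \<and> t = tri a b c)"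
  unfolding is_triangle_def span_two tri_def using independent_three by blast

lemma line_commute: "line a b = line b a"
  by (simp add: line_def ac_simps insert_commute)

lemma line_shift: "line a (a + b) = line a b"
  by (simp add: line_def ac_simps insert_commute)

text \<open>Over F_2 two independent vectors of a line are two of its three nonzero vectors, and the
  third is their sum.\<close>

lemma line_eqI:
  assumes "u \<in> line a b" "v \<in> line a b" "indep2 u v"
  shows "line u v = line a b"
proof -
  have "u = a \<or> u = b \<or> u = a + b" "v = a \<or> v = b \<or> v = a + b"
    using assms by (auto simp: line_def indep2_def)
  moreover have "line b a = line a b" "line a (a + b) = line a b" "line b (a + b) = line a b"
    "line (a + b) a = line a b" "line (a + b) b = line a b"
    by (simp_all add: line_def ac_simps insert_commute)
  moreover have "\<not> indep2 w w" for w
    by (simp add: indep2_def)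
  ultimately show ?thesis
    using assms(3) by metis
qed

lemma indep3_cases:
  "indep3 a b c \<longleftrightarrow> a \<noteq> 0 \<and> b \<noteq> 0 \<and> c \<noteq> 0 \<and> a \<noteq> b \<and> a \<noteq> c \<and> b \<noteq> c \<and> a + b \<noteq> c"
  by (auto simp: indep3_def indep2_def line_def)

lemma indep3_rotate: "indep3 a b c \<Longrightarrow> indep3 b c a"
  unfolding indep3_cases by (metis add_self_left add.commute)

section \<open>Decompositions of sets of lines into triangles\<close>

text \<open>This is a triangle design with the two-dimensional subspaces of \<open>V\<close>
  replaced by an arbitrary set of lines, so that pieces can be treated separately and glued. The
  inclusion \<open>t \<subseteq> L\<close> takes the place of the vertices lying in
  \<open>V\<close>.\<close>

definition decomposes :: "'v set set set \<Rightarrow> 'v set set \<Rightarrow> bool" where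
  "decomposes D L \<longleftrightarrow>
     (\<forall>t\<in>D. t \<subseteq> L \<and> (\<exists>a b c. indep3 a b c \<and> t = tri a b c)) \<and> (\<forall>W\<in>L. \<exists>!t. t \<in> D \<and> W \<in> t)"

definition decomposable :: "'v set set \<Rightarrow> bool" where
  "decomposable L \<longleftrightarrow> (\<exists>D. decomposes D L)"

lemma lines_subset:
  assumes "W \<in> lines V" "subspace V"
  shows "W \<subseteq> V"
  using assms subspace_add[OF assms(2)] subspace_0[OF assms(2)] by (auto simp: lines_def line_def)

lemma line_mem_linesD:
  assumes "line a b \<in> lines V" "subspace V"
  shows "a \<in> V" "b \<in> V"
  using lines_subset[OF assms] by (auto simp: line_def)

lemma line_mem_linesI: "a \<in> V \<Longrightarrow> b \<in> V \<Longrightarrow> indep2 a b \<Longrightarrow> line a b \<in> lines V"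
  by (auto simp: lines_def)

text \<open>Two sides of a triangle already contain all three vertices. This exchanges the condition
  on vertices in a design for a condition on sides.\<close>

lemma tri_subset_lines_iff:
  assumes V: "subspace V" and abc: "indep3 a b c"
  shows "tri a b c \<subseteq> lines V \<longleftrightarrow> a \<in> V \<and> b \<in> V \<and> c \<in> V"
proof
  assume "tri a b c \<subseteq> lines V"
  then have "line a b \<in> lines V" "line b c \<in> lines V"
    by (auto simp: tri_def)
  then show "a \<in> V \<and> b \<in> V \<and> c \<in> V"
    using line_mem_linesD[OF _ V] by blast
next
  assume "a \<in> V \<and> b \<in> V \<and> c \<in> V"
  moreover have "indep2 a b" "indep2 b c" "indep2 c a"
    using abc by (auto simp: indep3_cases indep2_def)
  ultimately show "tri a b c \<subseteq> lines V"
    using line_mem_linesI unfolding tri_def by blast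
qed

lemma design_iff_decomposable:
  assumes V: "subspace V"
  shows "(\<exists>D. is_triangle_design V D) \<longleftrightarrow> decomposable (lines V)"
proof -
  have "is_triangle V t \<longleftrightarrow> t \<subseteq> lines V \<and> (\<exists>a b c. indep3 a b c \<and> t = tri a b c)" for t
    unfolding is_triangle_iff using tri_subset_lines_iff[OF V] by blast
  then show ?thesis
    by (simp add: is_triangle_design_def decomposable_def decomposes_def two_dim_subspaces_eq_lines[OF V])
qed

lemma decomposable_tri: "indep3 a b c \<Longrightarrow> decomposable (tri a b c)"
  unfolding decomposable_def decomposes_def by (rule exI[of _ "{tri a b c}"]) auto

text \<open>The pieces are disjoint, so a line \<open>W\<close> fixes its piece. A triangle through
  \<open>W\<close> chosen for another piece would put \<open>W\<close> into that piece as well, so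
  uniqueness is inherited from the piece of \<open>W\<close>.\<close>

lemma decomposable_Union:
  assumes dec: "\<And>L. L \<in> F \<Longrightarrow> decomposable L"
    and disj: "\<And>L M W. L \<in> F \<Longrightarrow> M \<in> F \<Longrightarrow> W \<in> L \<Longrightarrow> W \<in> M \<Longrightarrow> L = M"
  shows "decomposable (\<Union>F)"
proof -
  have "\<exists>D. \<forall>L\<in>F. decomposes (D L) L"
    using dec unfolding decomposable_def by (intro bchoice) auto
  then obtain D where D: "\<And>L. L \<in> F \<Longrightarrow> decomposes (D L) L"
    by auto
  have "decomposes (\<Union>(D ` F)) (\<Union>F)"
    unfolding decomposes_def
  proof (intro conjI ballI)
    fix t assume "t \<in> \<Union>(D ` F)"
    then obtain L where L: "L \<in> F" "t \<in> D L"
      by auto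
    then have "t \<subseteq> L" and tri: "\<exists>a b c. indep3 a b c \<and> t = tri a b c"
      using D[OF L(1)] by (simp_all add: decomposes_def)
    then show "t \<subseteq> \<Union>F" "\<exists>a b c. indep3 a b c \<and> t = tri a b c"
      using L(1) by auto
  next
    fix W assume "W \<in> \<Union>F"
    then obtain L where L: "L \<in> F" "W \<in> L"
      by auto
    then have ex1: "\<exists>!t. t \<in> D L \<and> W \<in> t"
      using D[OF L(1)] by (simp add: decomposes_def)
    then obtain t where t: "t \<in> D L" "W \<in> t"
      by auto
    show "\<exists>!t. t \<in> \<Union>(D ` F) \<and> W \<in> t"
    proof (rule ex1I[of _ t])
      fix s assume "s \<in> \<Union>(D ` F) \<and> W \<in> s"
      then obtain M where M: "M \<in> F" "s \<in> D M" "W \<in> s"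
        by auto
      then have "s \<subseteq> M"
        using D[OF M(1)] by (simp add: decomposes_def)
      then have "M = L"
        using disj[OF M(1) L(1) _ L(2)] M(3) by auto
      then show "s = t"
        using ex1 M t by auto
    qed (use t L in auto)
  qed
  then show ?thesis
    by (auto simp: decomposable_def)
qed

lemma decomposable_Un:
  assumes "decomposable L" "decomposable M" "L \<inter> M = {}"
  shows "decomposable (L \<union> M)"
proof -
  have "decomposable (\<Union>{L, M})"
  proof (rule decomposable_Union)
    fix X Y W assume "X \<in> {L, M}" "Y \<in> {L, M}" "W \<in> X" "W \<in> Y"
    with assms(3) show "X = Y"
      by blast
  qed (use assms in blast)
  then show ?thesis
    by simp
qed

section \<open>The lines of a plane\<close>

text \<open>For \<open>b\<close> outside \<open>l\<close>: the lines other than \<open>l\<close> in the plane spanned by \<open>l\<close> and \<open>b\<close> that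
  do not contain \<open>b\<close>.\<close>

definition skew :: "'v set \<Rightarrow> 'v \<Rightarrow> 'v set set" where
  "skew l b = {line u (x + b) |u x. indep2 u x \<and> line u x = l}"

text \<open>The sum of two vertices cancels \<open>b\<close> and is one of \<open>a\<close>,
  \<open>c\<close>, \<open>a + c\<close>. Each side is thus generated by such a vector
  \<open>u\<close> and a vertex \<open>x + b\<close>; the two choices of \<open>x\<close> for a
  given \<open>u\<close> differ by \<open>u\<close> and yield the same side.\<close>

lemma skew_eq_tri:
  assumes "indep2 a c"
  shows "skew (line a c) b = tri (a + b) (c + b) (a + c + b)"
proof -
  have e: "line (a + b) (c + b) = line (a + c) (c + b)"
    "line (c + b) (a + c + b) = line a (c + b)"
    "line (a + c + b) (a + b) = line c (a + b)"
    by (simp_all add: line_def ac_simps insert_commute)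
  show ?thesis
  proof (intro equalityI subsetI)
    fix W assume "W \<in> skew (line a c) b"
    then obtain u x where ux: "indep2 u x" "line u x = line a c" "W = line u (x + b)"
      by (auto simp: skew_def)
    have "u \<in> line a c" "x \<in> line a c"
      unfolding ux(2)[symmetric] by (auto simp: line_def)
    then have "u = a \<or> u = c \<or> u = a + c" "x = a \<or> x = c \<or> x = a + c"
      using ux(1) by (auto simp: line_def indep2_def)
    moreover have "line a (a + c + b) = line a (c + b)" "line c (a + c + b) = line c (a + b)"
      "line (a + c) (a + b) = line (a + c) (c + b)"
      by (simp_all add: line_def ac_simps insert_commute)
    ultimately show "W \<in> tri (a + b) (c + b) (a + c + b)"
      unfolding tri_def e using ux(1,3) by (elim disjE) (auto simp: indep2_def)
  next
    fix W assume "W \<in> tri (a + b) (c + b) (a + c + b)"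
    then consider "W = line (a + c) (c + b)" | "W = line a (c + b)" | "W = line c (a + b)"
      by (auto simp: tri_def e)
    moreover have "indep2 (a + c) c" "line (a + c) c = line a c" "indep2 c a" "line c a = line a c"
      using assms by (auto simp: indep2_def line_def ac_simps insert_commute)
    ultimately show "W \<in> skew (line a c) b"
      unfolding skew_def using assms by cases blast+
  qed
qed

lemma decomposable_skew:
  assumes "indep3 a c b"
  shows "decomposable (skew (line a c) b)"
proof -
  have "indep2 a c" "indep3 (a + b) (c + b) (a + c + b)"
    using assms by (auto simp: indep3_cases indep2_def ac_simps)
  then show ?thesis
    by (simp add: skew_eq_tri decomposable_tri)
qed

text \<open>One triangle takes the joins of \<open>b\<close> with \<open>a\<close> and with
  \<open>c\<close> and the skew line through \<open>a\<close>; the other takes the join of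
  \<open>b\<close> with \<open>a + c\<close> and the skew lines through \<open>c\<close> and through
  \<open>a + c\<close>.\<close>

lemma decomposable_plane_minus_line:
  assumes "indep3 a c b"
  shows "decomposable (skew (line a c) b \<union> {line a b, line c b, line (a + c) b})"
proof -
  define e where "e = a + c"
  have "skew (line a c) b \<union> {line a b, line c b, line (a + c) b}
      = tri b a (c + b) \<union> tri e (e + b) (a + b)"
  proof -
    have "line (a + b) (c + b) = line e (a + b)" "line (c + b) (a + c + b) = line a (c + b)"
      "line (a + c + b) (a + b) = line c (a + b)" "line (c + b) b = line c b"
      "line e (e + b) = line e b" "line (e + b) (a + b) = line c (a + b)"
      by (simp_all add: line_def e_def ac_simps insert_commute)
    then show ?thesis
      using assms line_commute unfolding skew_eq_tri[OF indep3_def[THEN iffD1, THEN conjunct1, OF assms]] tri_def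
      by (auto simp: e_def)
  qed
  \<comment> \<open>Two sides of the first triangle contain \<open>a\<close>, which lies on no side
    of the second. The side \<open>line (c + b) b\<close> misses \<open>e\<close>, which lies on two
    sides of the second triangle, and contains \<open>b\<close>, which the remaining side
    misses.\<close>
  moreover have "tri b a (c + b) \<inter> tri e (e + b) (a + b) = {}"
  proof -
    have ne: "a \<noteq> 0" "c \<noteq> 0" "b \<noteq> 0" "a \<noteq> c" "a \<noteq> b" "c \<noteq> b" "a + c \<noteq> b" "a + b \<noteq> c" "c + b \<noteq> a"
      using assms indep3_rotate[OF assms] indep3_rotate[OF indep3_rotate[OF assms]]
      by (auto simp: indep3_cases ac_simps)
    have "a \<in> line b a" "a \<in> line a (c + b)" "b \<in> line (c + b) b"
      by (simp_all add: line_def)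
    moreover have "b \<notin> line (e + b) (a + b)" "a \<notin> line e (e + b)" "a \<notin> line (e + b) (a + b)"
      "a \<notin> line (a + b) e" "e \<notin> line (c + b) b"
      using ne ne[symmetric] by (simp_all add: line_def e_def ac_simps)
    moreover have "e \<in> line e (e + b)" "e \<in> line (a + b) e"
      by (simp_all add: line_def)
    ultimately show ?thesis
      unfolding tri_def by blast
  qed
  moreover have "indep3 b a (c + b)" "indep3 e (e + b) (a + b)"
    using assms by (auto simp: indep3_cases e_def ac_simps)
  ultimately show ?thesis
    by (simp add: decomposable_Un decomposable_tri)
qed

lemma line_same: "line a a = {0, a}" and line_0_left: "line 0 a = {0, a}" and line_0_right: "line a 0 = {0, a}"
  by (simp_all add: line_def insert_commute)

text \<open>Independence can be read off the cardinality. This later recovers the kind of a line,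
  and the independence of its generators, from its images under the projections.\<close>

lemma card_line: "card (line a b) = (if indep2 a b then 4 else if a = 0 \<and> b = 0 then 1 else 2)"
proof (cases "indep2 a b")
  case True
  then have "a \<noteq> 0" "b \<noteq> 0" "a \<noteq> b" "b \<noteq> a" "a \<noteq> a + b" "b \<noteq> a + b" "0 \<noteq> a + b"
    by (auto simp: indep2_def)
  then show ?thesis
    using True by (simp add: line_def)
next
  case False
  then consider "a = 0" | "b = 0" | "a = b"
    by (auto simp: indep2_def)
  then show ?thesis
    using False by cases (simp_all add: line_same line_0_left line_0_right card_insert_if)
qed

end

section \<open>Splitting by a projection, and the six kinds of lines\<close>

locale f2_splitting = f2_vector_space scale
  for scale :: "bit \<Rightarrow> 'v::ab_group_add \<Rightarrow> 'v" +
  fixes V :: "'v set" and p :: "'v \<Rightarrow> 'v"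
  assumes V: "subspace V"
    and p_add: "p (x + y) = p x + p y"
    and p_idem: "p (p x) = p x"
    and p_closed: "x \<in> V \<Longrightarrow> p x \<in> V"
begin

text \<open>The direct sum is encoded by the idempotent \<open>p\<close>, through its fixed points
  and its kernel in \<open>V\<close>. The complementary projection \<open>x - p x\<close> becomes
  \<open>x + p x\<close> in characteristic two.\<close>

definition A :: "'v set" where "A = {x \<in> V. p x = x}"
definition B :: "'v set" where "B = {x \<in> V. p x = 0}"
definition q :: "'v \<Rightarrow> 'v" where "q x = x + p x"

lemma p_0: "p 0 = 0"
  using p_add[of 0 0] by simp

lemma q_0: "q 0 = 0"
  by (simp add: q_def p_0)

lemma V_add: "x \<in> V \<Longrightarrow> y \<in> V \<Longrightarrow> x + y \<in> V"
  by (rule subspace_add[OF V])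

lemma subspace_A: "subspace A"
  by (rule f2_subspaceI) (simp_all add: A_def p_0 p_add V_add subspace_0[OF V])

lemma subspace_B: "subspace B"
  by (rule f2_subspaceI) (simp_all add: B_def p_0 p_add V_add subspace_0[OF V])

lemma p_A: "x \<in> A \<Longrightarrow> p x = x" and p_B: "x \<in> B \<Longrightarrow> p x = 0"
  and q_A: "x \<in> A \<Longrightarrow> q x = 0" and q_B: "x \<in> B \<Longrightarrow> q x = x"
  and A_V: "x \<in> A \<Longrightarrow> x \<in> V" and B_V: "x \<in> B \<Longrightarrow> x \<in> V"
  by (simp_all add: A_def B_def q_def)

lemmas A_add = subspace_add[OF subspace_A] and B_add = subspace_add[OF subspace_B]
  and A_0 = subspace_0[OF subspace_A] and B_0 = subspace_0[OF subspace_B]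

lemma q_add: "q (x + y) = q x + q y"
  by (simp add: q_def p_add ac_simps)

lemmas pq = p_A p_B q_A q_B p_add q_add

lemma p_mem: "x \<in> V \<Longrightarrow> p x \<in> A" and q_mem: "x \<in> V \<Longrightarrow> q x \<in> B"
  by (simp_all add: A_def B_def q_def p_idem p_add p_closed V_add)

lemma p_plus_q: "p x + q x = x"
  by (simp add: q_def ac_simps)

lemma p_line: "p ` line u v = line (p u) (p v)" and q_line: "q ` line u v = line (q u) (q v)"
  by (simp_all add: line_def p_add q_add p_0 q_0)

text \<open>The projection \<open>p\<close> kills \<open>b\<close> but fixes the nonzero vectors of
  \<open>line a c\<close>, so \<open>b\<close> is none of them.\<close>

lemma indep3_A_A_B:
  assumes "indep2 a c" "a \<in> A" "c \<in> A" "b \<in> B" "b \<noteq> 0"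
  shows "indep3 a c b"
proof -
  have "p x \<noteq> p b" if "x \<in> A" "x \<noteq> 0" for x
    using that assms(4) by (simp add: pq)
  then have "x \<noteq> b" if "x \<in> A" "x \<noteq> 0" for x
    using that by blast
  then show ?thesis
    using assms A_add[of a c] by (auto simp: indep3_cases indep2_def)
qed

lemma indep3_B_B_A:
  assumes "indep2 b d" "b \<in> B" "d \<in> B" "a \<in> A" "a \<noteq> 0"
  shows "indep3 b d a"
proof -
  have "p x \<noteq> p a" if "x \<in> B" "x \<noteq> 0" for x
    using that assms(4,5) by (simp add: pq)
  then have "x \<noteq> a" if "x \<in> B" "x \<noteq> 0" for x
    using that by blast
  then show ?thesis
    using assms B_add[of b d] by (auto simp: indep3_cases indep2_def)
qed

text \<open>Apart from the lines inside \<open>A\<close> or \<open>B\<close>, the kinds differ by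
  the dimensions of the images under \<open>p\<close> and \<open>q\<close>: 1 and 1 for
  \<open>cross\<close>, 2 and 1 for \<open>skewA\<close>, 1 and 2 for \<open>skewB\<close>, 2 and 2
  for \<open>graphs\<close>.\<close>

definition cross :: "'v set set" where
  "cross = {line a b |a b. a \<in> A - {0} \<and> b \<in> B - {0}}"
definition skewA :: "'v set set" where
  "skewA = (\<Union>l\<in>lines A. \<Union>b\<in>B - {0}. skew l b)"
definition skewB :: "'v set set" where
  "skewB = (\<Union>l\<in>lines B. \<Union>a\<in>A - {0}. skew l a)"
definition graphs :: "'v set set" where
  "graphs = {line (a + b) (c + d) |a b c d. a \<in> A \<and> c \<in> A \<and> b \<in> B \<and> d \<in> B \<and> indep2 a c \<and> indep2 b d}"

text \<open>If \<open>y\<close> is \<open>0\<close> or \<open>x\<close>, the line contains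
  \<open>b\<close> itself; otherwise \<open>x\<close> and \<open>y\<close> span a line of
  \<open>A\<close>.\<close>

lemma line_in_cross_or_skewA:
  assumes "x \<in> A" "x \<noteq> 0" "y \<in> A" "b \<in> B" "b \<noteq> 0"
  shows "line x (y + b) \<in> cross \<union> skewA"
proof (cases "y = 0 \<or> y = x")
  case True
  then have "line x (y + b) = line x b"
    by (elim disjE) (simp_all add: line_shift)
  then show ?thesis
    using assms unfolding cross_def by blast
next
  case False
  then have "indep2 x y"
    using assms by (auto simp: indep2_def)
  then have "line x y \<in> lines A" "line x (y + b) \<in> skew (line x y) b"
    using assms line_mem_linesI unfolding skew_def by blast+
  then show ?thesis
    using assms unfolding skewA_def by blast
qed

lemma line_in_cross_or_skewB:
  assumes "x \<in> B" "x \<noteq> 0" "y \<in> B" "a \<in> A" "a \<noteq> 0"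
  shows "line x (y + a) \<in> cross \<union> skewB"
proof (cases "y = 0 \<or> y = x")
  case True
  then have "line x (y + a) = line a x"
    unfolding line_commute[of a x] by (elim disjE) (simp_all add: line_shift)
  then show ?thesis
    using assms unfolding cross_def by blast
next
  case False
  then have "indep2 x y"
    using assms by (auto simp: indep2_def)
  then have "line x y \<in> lines B" "line x (y + a) \<in> skew (line x y) a"
    using assms line_mem_linesI unfolding skew_def by blast+
  then show ?thesis
    using assms unfolding skewB_def by blast
qed

lemma lines_V_subset: "lines V \<subseteq> lines A \<union> lines B \<union> cross \<union> skewA \<union> skewB \<union> graphs"
proof
  fix W assume "W \<in> lines V"
  then obtain u v where uv: "u \<in> V" "v \<in> V" "indep2 u v" "W = line u v"
    by (auto simp: lines_def)
  define a b c d where "a = p u" "b = q u" "c = p v" "d = q v"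
  then have mem: "a \<in> A" "c \<in> A" "b \<in> B" "d \<in> B" and eq: "u = a + b" "v = c + d"
    using uv by (simp_all add: p_mem q_mem p_plus_q)
  note W = uv(4)[unfolded eq] and ind = uv(3)[unfolded eq]
  \<comment> \<open>Adding the second generator to the first cancels equal components; this serves
    the cases \<open>d = b\<close> and \<open>c = a\<close>.\<close>
  have s: "line (a + b) (c + d) = line (a + b + (c + d)) (c + d)"
    using line_shift[of "c + d" "a + b"] line_commute by (metis add.commute)
  \<comment> \<open>The first four cases exhaust dependent \<open>b\<close> and \<open>d\<close>;
    for independent ones the dependence of \<open>a\<close> and \<open>c\<close> decides.\<close>
  consider "b = 0" "d = 0" | "b = 0" "d \<noteq> 0" | "b \<noteq> 0" "d = 0" | "b \<noteq> 0" "d = b"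
    | "indep2 b d" "a = 0" "c = 0" | "indep2 b d" "a = 0" "c \<noteq> 0" | "indep2 b d" "a \<noteq> 0" "c = 0"
    | "indep2 b d" "a \<noteq> 0" "c = a" | "indep2 b d" "indep2 a c"
    by (auto simp: indep2_def)
  then show "W \<in> lines A \<union> lines B \<union> cross \<union> skewA \<union> skewB \<union> graphs"
  proof cases
    case 1
    then have "W \<in> lines A"
      using W ind mem by (simp add: line_mem_linesI)
    then show ?thesis by blast
  next
    case 2
    then have "a \<noteq> 0" "W = line a (c + d)"
      using W ind by (simp_all add: indep2_def)
    then show ?thesis
      using line_in_cross_or_skewA[of a c d] mem 2 by blast
  next
    case 3
    then have "c \<noteq> 0" "W = line c (a + b)"
      using W ind line_commute[of "a + b" c] by (simp_all add: indep2_def)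
    then show ?thesis
      using line_in_cross_or_skewA[of c a b] mem 3 by blast
  next
    case 4
    then have "a + c \<noteq> 0" "W = line (a + c) (c + d)"
      using W ind s by (simp_all add: indep2_def ac_simps)
    then show ?thesis
      using line_in_cross_or_skewA[of "a + c" c d] mem 4 A_add by blast
  next
    case 5
    then have "W \<in> lines B"
      using W ind mem by (simp add: line_mem_linesI)
    then show ?thesis by blast
  next
    case 6
    then have "b \<noteq> 0" "W = line b (d + c)"
      using W by (simp_all add: indep2_def ac_simps)
    then show ?thesis
      using line_in_cross_or_skewB[of b d c] mem 6 by blast
  next
    case 7
    then have "d \<noteq> 0" "W = line d (b + a)"
      using W line_commute[of d] by (simp_all add: indep2_def ac_simps)
    then show ?thesis
      using line_in_cross_or_skewB[of d b a] mem 7 by blast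
  next
    case 8
    then have "b + d \<noteq> 0" "W = line (b + d) (d + c)"
      using W s by (simp_all add: indep2_def ac_simps)
    then show ?thesis
      using line_in_cross_or_skewB[of "b + d" d c] mem 8 B_add by blast
  next
    case 9
    then show ?thesis
      using W mem unfolding graphs_def by blast
  qed
qed

lemma indep2_V: "indep2 (p u) (p v) \<Longrightarrow> indep2 u v" "indep2 (q u) (q v) \<Longrightarrow> indep2 u v"
  using p_0 by (auto simp: indep2_def q_def)

lemma subset_lines_V: "lines A \<union> lines B \<union> cross \<union> skewA \<union> skewB \<union> graphs \<subseteq> lines V"
proof -
  have sk: "line u (x + b) \<in> lines V" if "u \<in> V" "x \<in> V" "b \<in> V" "indep2 u (x + b)" for u x b
    using that by (intro line_mem_linesI V_add) auto
  have "lines A \<subseteq> lines V" "lines B \<subseteq> lines V"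
    using A_V B_V unfolding lines_def by blast+
  moreover have "cross \<subseteq> lines V"
  proof -
    have "indep2 a b" if "a \<in> A" "b \<in> B" "a \<noteq> 0" "b \<noteq> 0" for a b
      using that p_A[of a] p_B[of b] by (auto simp: indep2_def)
    then show ?thesis
      using A_V B_V line_mem_linesI unfolding cross_def by blast
  qed
  moreover have "skewA \<subseteq> lines V"
  proof
    fix W assume "W \<in> skewA"
    then obtain l b u x where W: "l \<in> lines A" "b \<in> B" "b \<noteq> 0" "indep2 u x" "line u x = l" "W = line u (x + b)"
      unfolding skewA_def skew_def by blast
    then have "u \<in> A" "x \<in> A"
      using line_mem_linesD[OF _ subspace_A] by blast+
    then show "W \<in> lines V"
      using W A_V B_V indep2_V(1)[of u "x + b"] by (simp add: pq sk)
  qed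
  moreover have "skewB \<subseteq> lines V"
  proof
    fix W assume "W \<in> skewB"
    then obtain l b u x where W: "l \<in> lines B" "b \<in> A" "b \<noteq> 0" "indep2 u x" "line u x = l" "W = line u (x + b)"
      unfolding skewB_def skew_def by blast
    then have "u \<in> B" "x \<in> B"
      using line_mem_linesD[OF _ subspace_B] by blast+
    then show "W \<in> lines V"
      using W A_V B_V indep2_V(2)[of u "x + b"] by (simp add: pq sk)
  qed
  moreover have "graphs \<subseteq> lines V"
  proof
    fix W assume "W \<in> graphs"
    then obtain a b c d where W: "W = line (a + b) (c + d)" "a \<in> A" "c \<in> A" "b \<in> B" "d \<in> B" "indep2 a c"
      unfolding graphs_def by blast
    then show "W \<in> lines V"
      using A_V B_V indep2_V(1)[of "a + b" "c + d"] V_add by (simp add: pq line_mem_linesI)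
  qed
  ultimately show ?thesis by blast
qed

text \<open>Separates the six kinds of lines.\<close>

definition card_type :: "'v set \<Rightarrow> nat \<times> nat" where
  "card_type W = (card (p ` W), card (q ` W))"

lemma card_type_line: "card_type (line u v) = (card (line (p u) (p v)), card (line (q u) (q v)))"
  by (simp add: card_type_def p_line q_line)

text \<open>The projections recover both \<open>l\<close> and \<open>b\<close> from
  \<open>W\<close>, so the sets \<open>skew l b\<close> for different pairs are disjoint.\<close>

lemma skewA_images:
  assumes "W \<in> skew l b" "l \<in> lines A" "b \<in> B"
  shows "p ` W = l" "q ` W = {0, b}"
proof -
  obtain u x where W: "line u x = l" "W = line u (x + b)"
    using assms(1) unfolding skew_def by blast
  then have "u \<in> A" "x \<in> A"
    using line_mem_linesD[OF _ subspace_A] assms(2) by blast+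
  then show "p ` W = l" "q ` W = {0, b}"
    using W assms(3) by (simp_all add: p_line q_line pq line_0_left)
qed

lemma skewB_images:
  assumes "W \<in> skew l a" "l \<in> lines B" "a \<in> A"
  shows "p ` W = {0, a}" "q ` W = l"
proof -
  obtain u x where W: "line u x = l" "W = line u (x + a)"
    using assms(1) unfolding skew_def by blast
  then have "u \<in> B" "x \<in> B"
    using line_mem_linesD[OF _ subspace_B] assms(2) by blast+
  then show "p ` W = {0, a}" "q ` W = l"
    using W assms(3) by (simp_all add: p_line q_line pq line_0_left)
qed

lemma card_of_lines: "l \<in> lines U \<Longrightarrow> card l = 4"
  by (auto simp: lines_def card_line)

lemma card_pair: "a \<noteq> 0 \<Longrightarrow> card {0, a} = 2"
  by simp

lemma card_type_A: "W \<in> lines A \<Longrightarrow> card_type W = (4, 1)"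
  and card_type_B: "W \<in> lines B \<Longrightarrow> card_type W = (1, 4)"
  and card_type_cross: "W \<in> cross \<Longrightarrow> card_type W = (2, 2)"
  and card_type_graphs: "W \<in> graphs \<Longrightarrow> card_type W = (4, 4)"
  by (auto simp: lines_def cross_def graphs_def card_type_line pq card_line indep2_def)

lemma card_type_skewA: "W \<in> skewA \<Longrightarrow> card_type W = (4, 2)"
proof -
  assume "W \<in> skewA"
  then obtain l b where W: "l \<in> lines A" "b \<in> B" "b \<noteq> 0" "W \<in> skew l b"
    unfolding skewA_def by blast
  show ?thesis
    unfolding card_type_def skewA_images[OF W(4,1,2)] using W(1,3) card_of_lines by simp
qed

lemma card_type_skewB: "W \<in> skewB \<Longrightarrow> card_type W = (2, 4)"
proof -
  assume "W \<in> skewB"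
  then obtain l b where W: "l \<in> lines B" "b \<in> A" "b \<noteq> 0" "W \<in> skew l b"
    unfolding skewB_def by blast
  show ?thesis
    unfolding card_type_def skewB_images[OF W(4,1,2)] using W(1,3) card_of_lines by simp
qed

section \<open>Triangles for the mixed lines and for the graphs\<close>

lemma decomposable_skewB: "decomposable skewB"
proof -
  have "skewB = \<Union>{skew l a |l a. l \<in> lines B \<and> a \<in> A - {0}}"
    unfolding skewB_def by blast
  also have "decomposable \<dots>"
  proof (rule decomposable_Union)
    fix L assume "L \<in> {skew l a |l a. l \<in> lines B \<and> a \<in> A - {0}}"
    then obtain b d a where "L = skew (line b d) a" "b \<in> B" "d \<in> B" "indep2 b d" "a \<in> A" "a \<noteq> 0"
      unfolding lines_def by blast
    then show "decomposable L"
      using decomposable_skew[OF indep3_B_B_A] by simp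
  next
    fix L M W
    assume "L \<in> {skew l a |l a. l \<in> lines B \<and> a \<in> A - {0}}" "M \<in> {skew l a |l a. l \<in> lines B \<and> a \<in> A - {0}}"
      and W: "W \<in> L" "W \<in> M"
    then obtain l a l' a' where L: "L = skew l a" "l \<in> lines B" "a \<in> A" "a \<noteq> 0"
      and M: "M = skew l' a'" "l' \<in> lines B" "a' \<in> A" "a' \<noteq> 0"
      by blast
    have "l = l'" "{0, a} = {0, a'}"
      using skewB_images[OF W(1)[unfolded L(1)] L(2,3)] skewB_images[OF W(2)[unfolded M(1)] M(2,3)] by simp_all
    then show "L = M"
      using L(1,4) M(1,4) by (auto simp: doubleton_eq_iff)
  qed
  finally show ?thesis .
qed

lemma decomposable_cross_skewA:
  assumes spread: "\<And>l. l \<in> S \<Longrightarrow> l \<in> lines A" "\<And>a. a \<in> A \<Longrightarrow> a \<noteq> 0 \<Longrightarrow> \<exists>!l. l \<in> S \<and> a \<in> l"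
  shows "decomposable (cross \<union> skewA)"
proof -
  \<comment> \<open>The joins of \<open>b\<close> with the points of \<open>l\<close> are attached
    only when \<open>l\<close> is in the spread, so that each line of \<open>cross\<close> falls
    into exactly one piece.\<close>
  define F where "F l b = skew l b \<union> (if l \<in> S then {line x b |x. x \<in> l - {0}} else {})" for l b
  define \<F> where "\<F> = {F l b |l b. l \<in> lines A \<and> b \<in> B - {0}}"
  have "cross \<union> skewA = \<Union>\<F>"
  proof (intro equalityI subsetI)
    fix W assume "W \<in> cross \<union> skewA"
    then consider "W \<in> skewA" | a b where "W = line a b" "a \<in> A" "a \<noteq> 0" "b \<in> B - {0}"
      unfolding cross_def by blast
    then show "W \<in> \<Union>\<F>"
    proof cases
      case 1
      then show ?thesis
        unfolding skewA_def \<F>_def F_def by blast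
    next
      case 2
      then obtain l where l: "l \<in> S" "a \<in> l"
        using spread(2) by blast
      then have "W \<in> F l b"
        using 2 unfolding F_def by auto
      then show ?thesis
        using l(1) 2 spread(1) unfolding \<F>_def by blast
    qed
  next
    fix W assume "W \<in> \<Union>\<F>"
    then obtain l b where l: "l \<in> lines A" "b \<in> B - {0}" "W \<in> F l b"
      unfolding \<F>_def by blast
    then consider "W \<in> skew l b" | x where "W = line x b" "x \<in> l" "x \<noteq> 0"
      unfolding F_def by (auto split: if_splits)
    then show "W \<in> cross \<union> skewA"
    proof cases
      case 1
      then show ?thesis
        using l unfolding skewA_def by blast
    next
      case 2
      then show ?thesis
        using l lines_subset[OF l(1) subspace_A] unfolding cross_def by blast
    qed
  qed
  also have "decomposable \<dots>"
  proof (rule decomposable_Union)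
    fix L assume "L \<in> \<F>"
    then obtain a c b where L: "L = F (line a c) b" "a \<in> A" "c \<in> A" "indep2 a c" "b \<in> B" "b \<noteq> 0"
      unfolding \<F>_def lines_def by blast
    have ind: "indep3 a c b"
      using L by (intro indep3_A_A_B)
    have "line a c - {0} = {a, c, a + c}"
      using L(4) by (auto simp: line_def indep2_def)
    then have "{line x b |x. x \<in> line a c - {0}} = {line a b, line c b, line (a + c) b}"
      by auto
    then show "decomposable L"
      using decomposable_skew[OF ind] decomposable_plane_minus_line[OF ind] unfolding L(1) F_def by simp
  next
    \<comment> \<open>The image under \<open>q\<close> determines \<open>b\<close>. The image under
      \<open>p\<close> is either \<open>l\<close> or a single nonzero vector, and in the latter case
      \<open>l\<close> is the spread line through that vector.\<close>
    have img: "q ` W = {0, b} \<and> (p ` W = l \<or> l \<in> S \<and> (\<exists>x. x \<in> l \<and> x \<in> A \<and> x \<noteq> 0 \<and> p ` W = {0, x}))"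
      if "W \<in> F l b" "l \<in> lines A" "b \<in> B" for W l b
    proof (cases "W \<in> skew l b")
      case True
      then show ?thesis
        using skewA_images that by blast
    next
      case False
      then have "l \<in> S" "W \<in> {line x b |x. x \<in> l - {0}}"
        using that(1) unfolding F_def by (simp_all split: if_splits)
      then obtain x where x: "W = line x b" "x \<in> l" "x \<noteq> 0" "l \<in> S"
        by blast
      moreover have "x \<in> A"
        using lines_subset[OF that(2) subspace_A] x(2) by blast
      moreover have "q ` W = {0, b}" "p ` W = {0, x}"
        using x(1) \<open>x \<in> A\<close> that(3) by (simp_all add: p_line q_line pq line_0_left line_0_right)
      ultimately show ?thesis
        by blast
    qed
    fix L M W
    assume "L \<in> \<F>" "M \<in> \<F>" and W: "W \<in> L" "W \<in> M"
    then obtain l b l' b' where L: "L = F l b" "l \<in> lines A" "b \<in> B" "b \<noteq> 0"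
      and M: "M = F l' b'" "l' \<in> lines A" "b' \<in> B" "b' \<noteq> 0"
      unfolding \<F>_def by blast
    note iL = img[OF W(1)[unfolded L(1)] L(2,3)] and iM = img[OF W(2)[unfolded M(1)] M(2,3)]
    have "{0, b} = {0, b'}"
      using iL iM by simp
    then have "b = b'"
      using L(4) M(4) by (auto simp: doubleton_eq_iff)
    moreover have "l = l'"
    \<comment> \<open>With four elements the image is \<open>l\<close> itself and also
      \<open>l'\<close>. Otherwise \<open>l\<close> and \<open>l'\<close> are spread lines through
      the same vector.\<close>
    proof (cases "card (p ` W) = 4")
      case True
      then have "p ` W \<noteq> {0, x}" if "x \<noteq> 0" for x
        using card_pair[OF that] by auto
      then show ?thesis
        using iL iM by metis
    next
      case False
      then have "p ` W \<noteq> l" "p ` W \<noteq> l'"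
        using False card_of_lines[OF L(2)] card_of_lines[OF M(2)] by metis+
      then have "l \<in> S \<and> (\<exists>x. x \<in> l \<and> x \<in> A \<and> x \<noteq> 0 \<and> p ` W = {0, x})"
        "l' \<in> S \<and> (\<exists>x. x \<in> l' \<and> x \<in> A \<and> x \<noteq> 0 \<and> p ` W = {0, x})"
        using iL iM by metis+
      then obtain x x' where x: "l \<in> S" "x \<in> l" "x \<in> A" "x \<noteq> 0" "p ` W = {0, x}"
        and x': "l' \<in> S" "x' \<in> l'" "x' \<noteq> 0" "p ` W = {0, x'}"
        by metis
      have "{0, x} = {0, x'}"
        using x(5) x'(4) by simp
      then have "x = x'"
        using x(4) x'(3) by (auto simp: doubleton_eq_iff)
      then show ?thesis
        using spread(2)[OF x(3,4)] x(1,2) x'(1,2) by blast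
    qed
    ultimately show "L = M"
      using L(1) M(1) by simp
  qed
  finally show ?thesis .
qed

text \<open>As \<open>a\<close> and \<open>c\<close> are independent, \<open>p\<close> is injective
  on the line, which therefore has only one point above \<open>a\<close> and one above
  \<open>c\<close>.\<close>

lemma graph_line_unique:
  assumes eq: "line (a + b) (c + d) = line (a + b') (c + d')"
    and mem: "a \<in> A" "c \<in> A" "b \<in> B" "d \<in> B" "b' \<in> B" "d' \<in> B" and ind: "indep2 a c"
  shows "b = b'" "d = d'"
proof -
  have "a + b \<in> line (a + b') (c + d')" "c + d \<in> line (a + b') (c + d')"
    unfolding eq[symmetric] by (simp_all add: line_def)
  moreover have "p (a + b) = a" "p (c + d) = c" "p (a + b') = a" "p (c + d') = c" "p (a + b' + (c + d')) = a + c"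
    using mem by (simp_all add: pq)
  moreover have "a \<noteq> 0" "a \<noteq> c" "a \<noteq> a + c" "c \<noteq> 0" "c \<noteq> a" "c \<noteq> a + c"
    using ind by (auto simp: indep2_def)
  ultimately have "a + b = a + b'" "c + d = c + d'"
    unfolding line_def using p_0 by (metis empty_iff insert_iff)+
  then show "b = b'" "d = d'"
    by simp_all
qed

text \<open>A graph can be described over any basis of the line below it: lift \<open>x\<close> and
  \<open>y\<close> to points of the graph and take their \<open>q\<close> components.\<close>

lemma graph_line_rebase:
  assumes mem: "a \<in> A" "c \<in> A" "b \<in> B" "d \<in> B" and bd: "indep2 b d"
    and xy: "indep2 x y" "line a c = line x y"
  obtains b' d' where "b' \<in> B" "d' \<in> B" "indep2 b' d'" "line (a + b) (c + d) = line (x + b') (y + d')"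
proof -
  define W where "W = line (a + b) (c + d)"
  have pW: "p ` W = line x y" and qW: "q ` W = line b d"
    using mem xy(2) by (simp_all add: W_def p_line q_line pq)
  have "x \<in> p ` W" "y \<in> p ` W"
    unfolding pW by (simp_all add: line_def)
  then obtain u v where uv: "u \<in> W" "v \<in> W" "x = p u" "y = p v"
    by blast
  have eq: "W = line u v"
    using line_eqI[of u "a + b" "c + d" v] uv xy(1) indep2_V(1) unfolding W_def by blast
  have "W \<subseteq> V"
    using mem A_V B_V V_add subspace_0[OF V] by (auto simp: W_def line_def)
  then have "q u \<in> B" "q v \<in> B"
    using uv q_mem by blast+
  \<comment> \<open>The image under \<open>q\<close> does not depend on the generators chosen, so it
    still has four elements.\<close>
  moreover have "indep2 (q u) (q v)"
  proof -
    have "line (q u) (q v) = line b d"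
      using qW unfolding eq q_line .
    then have "card (line (q u) (q v)) = 4"
      using bd by (simp add: card_line)
    then show ?thesis
      by (simp add: card_line split: if_splits)
  qed
  moreover have "line (a + b) (c + d) = line (x + q u) (y + q v)"
    using eq uv(3,4) by (simp add: W_def p_plus_q)
  ultimately show ?thesis
    using that by blast
qed

lemma graph_lineI:
  "a \<in> A \<Longrightarrow> c \<in> A \<Longrightarrow> b \<in> B \<Longrightarrow> d \<in> B \<Longrightarrow> indep2 a c \<Longrightarrow> indep2 b d \<Longrightarrow> line (a + b) (c + d) \<in> graphs"
  unfolding graphs_def by blast

lemma decomposable_graphs:
  assumes "decomposable (lines A)"
  shows "decomposable graphs"
proof -
  obtain D where dec: "decomposes D (lines A)"
    using assms by (auto simp: decomposable_def)
  then have D: "\<And>t. t \<in> D \<Longrightarrow> t \<subseteq> lines A" "\<And>l. l \<in> lines A \<Longrightarrow> \<exists>!t. t \<in> D \<and> l \<in> t"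
    by (simp_all add: decomposes_def)
  have "\<forall>t\<in>D. \<exists>a b c. indep3 a b c \<and> t = tri a b c"
    using dec by (simp add: decomposes_def)
  \<comment> \<open>An order of the vertices is fixed for every triangle, because \<open>B\<close>
    components will be assigned by position.\<close>
  then obtain x y z where xyz: "\<And>t. t \<in> D \<Longrightarrow> indep3 (x t) (y t) (z t) \<and> t = tri (x t) (y t) (z t)"
    by metis
  have ind: "indep2 (x t) (y t)" "indep2 (y t) (z t)" "indep2 (z t) (x t)"
    and mem: "x t \<in> A" "y t \<in> A" "z t \<in> A" if "t \<in> D" for t
    using xyz[OF that] D(1)[OF that] tri_subset_lines_iff[OF subspace_A, of "x t" "y t" "z t"]
    by (auto simp: indep3_cases indep2_def)
  \<comment> \<open>The three \<open>B\<close> components sum to zero, so any two of them determine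
    the third.\<close>
  define G where "G t b d = tri (x t + b) (y t + d) (z t + (b + d))" for t b d
  define \<G> where "\<G> = {G t b d |t b d. t \<in> D \<and> b \<in> B \<and> d \<in> B \<and> indep2 b d}"
  have ind_B: "indep2 d (b + d)" "indep2 (b + d) b" if "indep2 b d" for b d
    using that by (auto simp: indep2_def)
  have "graphs = \<Union>\<G>"
  proof (intro equalityI subsetI)
    fix W assume "W \<in> graphs"
    then obtain a b c d where W: "W = line (a + b) (c + d)" and ac: "a \<in> A" "c \<in> A" "indep2 a c"
      and bd: "b \<in> B" "d \<in> B" "indep2 b d"
      unfolding graphs_def by blast
    then obtain t where t: "t \<in> D" "line a c \<in> t"
      using D(2) line_mem_linesI by metis
    then consider "line a c = line (x t) (y t)" | "line a c = line (y t) (z t)" | "line a c = line (z t) (x t)"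
      using xyz unfolding tri_def by blast
    then have "\<exists>b' d'. b' \<in> B \<and> d' \<in> B \<and> indep2 b' d' \<and> W \<in> G t b' d'"
    proof cases
      case 1
      then obtain b' d' where "b' \<in> B" "d' \<in> B" "indep2 b' d'" "W = line (x t + b') (y t + d')"
        using graph_line_rebase[OF ac(1,2) bd ind(1)[OF t(1)] 1] W by metis
      then show ?thesis
        unfolding G_def tri_def by blast
    next
      case 2
      then obtain b' d' where bd': "b' \<in> B" "d' \<in> B" "indep2 b' d'" "W = line (y t + b') (z t + d')"
        using graph_line_rebase[OF ac(1,2) bd ind(2)[OF t(1)] 2] W by metis
      \<comment> \<open>The components at \<open>y t\<close> and \<open>z t\<close> are prescribed
        here, so the one at \<open>x t\<close> has to be their sum.\<close>
      have "W \<in> G t (b' + d') b'"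
        using bd'(4) by (simp add: G_def tri_def ac_simps)
      then show ?thesis
        using bd' B_add[of b' d'] ind_B[OF bd'(3)] by blast
    next
      case 3
      then obtain b' d' where bd': "b' \<in> B" "d' \<in> B" "indep2 b' d'" "W = line (z t + b') (x t + d')"
        using graph_line_rebase[OF ac(1,2) bd ind(3)[OF t(1)] 3] W by metis
      have "W \<in> G t d' (b' + d')"
        using bd'(4) by (simp add: G_def tri_def ac_simps)
      then show ?thesis
        using bd' B_add[of b' d'] ind_B[OF bd'(3)] by blast
    qed
    then show "W \<in> \<Union>\<G>"
      using t(1) unfolding \<G>_def by blast
  next
    fix W assume "W \<in> \<Union>\<G>"
    then obtain t b d where t: "t \<in> D" and bd: "b \<in> B" "d \<in> B" "indep2 b d" and W: "W \<in> G t b d"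
      unfolding \<G>_def by blast
    then show "W \<in> graphs"
      using graph_lineI ind[OF t] mem[OF t] ind_B[OF bd(3)] B_add[OF bd(1,2)]
      unfolding G_def tri_def by blast
  qed
  also have "decomposable \<dots>"
  proof (rule decomposable_Union)
    fix L assume "L \<in> \<G>"
    then obtain t b d where t: "t \<in> D" and bd: "b \<in> B" "d \<in> B" and L: "L = G t b d"
      unfolding \<G>_def by blast
    have "p (x t + b) = x t" "p (y t + d) = y t" "p (z t + (b + d)) = z t"
      using bd mem[OF t] B_add[OF bd] by (simp_all add: pq)
    then have "indep3 (x t + b) (y t + d) (z t + (b + d))"
      using xyz[OF t] p_0 p_add unfolding indep3_cases by metis
    then show "decomposable L"
      unfolding L G_def by (rule decomposable_tri)
  next
    fix L M W assume "L \<in> \<G>" "M \<in> \<G>" and W: "W \<in> L" "W \<in> M"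
    then obtain t b d s b' d' where t: "t \<in> D" and bd: "b \<in> B" "d \<in> B" and L: "L = G t b d"
      and s: "s \<in> D" and bd': "b' \<in> B" "d' \<in> B" and M: "M = G s b' d'"
      unfolding \<G>_def by blast
    have im: "p ` line (x t + b) (y t + d) = line (x t) (y t)"
      "p ` line (y t + d) (z t + (b + d)) = line (y t) (z t)"
      "p ` line (z t + (b + d)) (x t + b) = line (z t) (x t)" if "t \<in> D" "b \<in> B" "d \<in> B" for t b d
      using mem[OF that(1)] that(2,3) B_add[OF that(2,3)] by (simp_all add: p_line pq)
    have img: "p ` W \<in> t" if "W \<in> G t b d" "t \<in> D" "b \<in> B" "d \<in> B" for W t b d
    proof -
      have "p ` W \<in> tri (x t) (y t) (z t)"
        using that(1) unfolding G_def tri_def by (elim insertE emptyE) (simp_all add: im[OF that(2-4)])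
      then show ?thesis
        using xyz[OF that(2)] by simp
    qed
    have "p ` W \<in> t" "p ` W \<in> s"
      using img[OF _ t bd] img[OF _ s bd'] W L M by simp_all
    moreover have "p ` W \<in> lines A"
      using D(1)[OF t] calculation(1) by (rule subsetD)
    \<comment> \<open>The projection of \<open>W\<close> is a side of both \<open>t\<close> and
      \<open>s\<close>, and a line of \<open>A\<close> is a side of only one triangle of
      \<open>D\<close>.\<close>
    ultimately have st: "s = t"
      using D(2) t s by blast
    \<comment> \<open>Since the sides of \<open>t\<close> are distinct, \<open>W\<close> has the
      same position in both triangles, and the components can be compared vertex by vertex.\<close>
    have ne: "line (x t) (y t) \<noteq> line (y t) (z t)" "line (y t) (z t) \<noteq> line (z t) (x t)" "line (z t) (x t) \<noteq> line (x t) (y t)"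
    proof -
      note i = xyz[OF t, THEN conjunct1]
      have "z t \<notin> line (x t) (y t)" "x t \<notin> line (y t) (z t)"
        using i indep3_rotate[OF i] by (simp_all add: indep3_def)
      moreover have "z t \<in> line (y t) (z t)" "z t \<in> line (z t) (x t)" "x t \<in> line (z t) (x t)"
        by (simp_all add: line_def)
      ultimately show "line (x t) (y t) \<noteq> line (y t) (z t)" "line (y t) (z t) \<noteq> line (z t) (x t)" "line (z t) (x t) \<noteq> line (x t) (y t)"
        by blast+
    qed
    have "W \<in> G t b d" "W \<in> G t b' d'"
      using W L M st by simp_all
    then consider "W = line (x t + b) (y t + d)" "W = line (x t + b') (y t + d')"
      | "W = line (y t + d) (z t + (b + d))" "W = line (y t + d') (z t + (b' + d'))"
      | "W = line (z t + (b + d)) (x t + b)" "W = line (z t + (b' + d')) (x t + b')"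
      using im[OF t bd] im[OF t bd'] ne unfolding G_def tri_def by (metis empty_iff insert_iff)
    then have "b = b' \<and> d = d'"
    proof cases
      case 1
      then show ?thesis
        using graph_line_unique[of "x t" b "y t" d b' d'] bd bd' mem[OF t] ind[OF t] by simp
    next
      case 2
      then have "d = d' \<and> b + d = b' + d'"
        using graph_line_unique[of "y t" d "z t" "b + d" d' "b' + d'"] bd bd' mem[OF t] ind[OF t] B_add by simp
      then show ?thesis by auto
    next
      case 3
      then have "b + d = b' + d' \<and> b = b'"
        using graph_line_unique[of "z t" "b + d" "x t" b "b' + d'" b'] bd bd' mem[OF t] ind[OF t] B_add by simp
      then show ?thesis by auto
    qed
    then show "L = M"
      using L M st by simp
  qed
  finally show ?thesis .
qed

text \<open>The lines of \<open>cross\<close> are decomposed together with \<open>skewA\<close>,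
  where the spread lines absorb them. The five pieces are disjoint because no two of them share a
  value of \<open>card_type\<close>.\<close>

theorem decomposable_lines_V:
  assumes A: "decomposable (lines A)" and B: "decomposable (lines B)"
    and spread: "\<And>l. l \<in> S \<Longrightarrow> l \<in> lines A" "\<And>a. a \<in> A \<Longrightarrow> a \<noteq> 0 \<Longrightarrow> \<exists>!l. l \<in> S \<and> a \<in> l"
  shows "decomposable (lines V)"
proof -
  have "lines V = lines A \<union> lines B \<union> (cross \<union> skewA) \<union> skewB \<union> graphs"
    using lines_V_subset subset_lines_V by blast
  moreover have "decomposable (lines A \<union> lines B \<union> (cross \<union> skewA) \<union> skewB \<union> graphs)"
  proof (rule decomposable_Un[OF decomposable_Un[OF decomposable_Un[OF decomposable_Un[OF A B]
          decomposable_cross_skewA[OF spread]] decomposable_skewB] decomposable_graphs[OF A]])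
    show "lines A \<inter> lines B = {}"
      using card_type_A card_type_B by fastforce
    show "(lines A \<union> lines B) \<inter> (cross \<union> skewA) = {}"
      using card_type_A card_type_B card_type_cross card_type_skewA by fastforce
    show "(lines A \<union> lines B \<union> (cross \<union> skewA)) \<inter> skewB = {}"
      using card_type_A card_type_B card_type_cross card_type_skewA card_type_skewB by fastforce
    show "(lines A \<union> lines B \<union> (cross \<union> skewA) \<union> skewB) \<inter> graphs = {}"
      using card_type_A card_type_B card_type_cross card_type_skewA card_type_skewB card_type_graphs by fastforce
  qed
  ultimately show ?thesis
    by simp
qed

end

section \<open>Transport along injective additive maps, and line spreads\<close>

context f2_vector_space
begin

lemma decomposes_image:
  assumes f_add: "\<And>x y. f (x + y) = f x + f y" and f_inj: "inj f" and D: "decomposes D L"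
  shows "decomposes ((`) ((`) f) ` D) ((`) f ` L)"
proof -
  define g where "g = (`) f"
  have g_inj: "g W = g W' \<longleftrightarrow> W = W'" for W W'
    using f_inj by (simp add: g_def inj_image_eq_iff)
  have f_0: "f 0 = 0"
    using f_add[of 0 0] by simp
  have f_eq: "f x = f y \<longleftrightarrow> x = y" for x y
    using f_inj by (simp add: inj_eq)
  have f_eq_0: "f x = 0 \<longleftrightarrow> x = 0" for x
    using f_eq[of x 0] f_0 by simp
  have ind: "indep3 (f a) (f b) (f c)" if "indep3 a b c" for a b c
    using that unfolding indep3_cases f_eq_0 f_eq f_add[symmetric] .
  have tri: "g ` tri a b c = tri (f a) (f b) (f c)" for a b c
    by (simp add: tri_def line_def g_def f_add f_0)
  have "g ` t \<subseteq> g ` L \<and> (\<exists>a b c. indep3 a b c \<and> g ` t = tri a b c)" if t: "t \<in> D" for t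
  proof -
    have "t \<subseteq> L" "\<exists>a b c. indep3 a b c \<and> t = tri a b c"
      using D t by (simp_all add: decomposes_def)
    then show ?thesis
      using ind tri image_mono by blast
  qed
  moreover have "\<exists>!t. t \<in> (`) g ` D \<and> g W \<in> t" if W: "W \<in> L" for W
  proof -
    have "\<exists>!t. t \<in> D \<and> W \<in> t"
      using D W by (simp add: decomposes_def)
    then obtain t where t: "t \<in> D" "W \<in> t" and u: "\<And>s. s \<in> D \<Longrightarrow> W \<in> s \<Longrightarrow> s = t"
      by metis
    show ?thesis
    proof (rule ex1I[of _ "g ` t"])
      fix s assume s: "s \<in> (`) g ` D \<and> g W \<in> s"
      then obtain s' where s': "s' \<in> D" "s = g ` s'"
        by blast
      then have "W \<in> s'"
        using s g_inj by (metis imageE)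
      then show "s = g ` t"
        using u s' by simp
    qed (use t in blast)
  qed
  ultimately show ?thesis
    unfolding decomposes_def g_def by simp
qed

lemma decomposable_lines_image:
  assumes f_add: "\<And>x y. f (x + y) = f x + f y" and f_inj: "inj f" and U: "decomposable (lines U)"
  shows "decomposable (lines (f ` U))"
proof -
  have f_0: "f 0 = 0"
    using f_add[of 0 0] by simp
  have line: "f ` line a b = line (f a) (f b)" for a b
    by (simp add: line_def f_add f_0)
  have ind: "indep2 (f a) (f b) \<longleftrightarrow> indep2 a b" for a b
    using f_inj inj_eq[OF f_inj, of _ 0] by (simp add: indep2_def f_0 inj_eq)
  have "lines (f ` U) = (`) f ` lines U"
  proof (intro equalityI subsetI)
    fix W assume "W \<in> lines (f ` U)"
    then obtain a b where ab: "a \<in> U" "b \<in> U" "indep2 (f a) (f b)" "W = line (f a) (f b)"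
      unfolding lines_def by blast
    then have "line a b \<in> lines U" "W = f ` line a b"
      by (simp_all add: line ind line_mem_linesI)
    then show "W \<in> (`) f ` lines U"
      by blast
  next
    fix W assume "W \<in> (`) f ` lines U"
    then obtain a b where ab: "a \<in> U" "b \<in> U" "indep2 a b" "W = f ` line a b"
      unfolding lines_def by blast
    then show "W \<in> lines (f ` U)"
      by (simp add: line ind line_mem_linesI)
  qed
  moreover obtain D where "decomposes D (lines U)"
    using U by (auto simp: decomposable_def)
  ultimately show ?thesis
    using decomposes_image[OF f_add f_inj] unfolding decomposable_def by metis
qed

text \<open>The equation w^2 = w + 1 lets \<open>w\<close> act as a generator of F_4, so
  \<open>U\<close> becomes a vector space over F_4. Its one-dimensional subspaces over F_4 are the
  sets \<open>line a (w a)\<close> with \<open>a\<close> nonzero, and they partition the nonzero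
  vectors.\<close>

lemma line_spread:
  assumes U: "subspace U" and w: "\<And>x. x \<in> U \<Longrightarrow> w x \<in> U" "\<And>x y. w (x + y) = w x + w y"
    "\<And>x. w (w x) = w x + x"
  shows "\<exists>S\<subseteq>lines U. \<forall>a\<in>U - {0}. \<exists>!l. l \<in> S \<and> a \<in> l"
proof -
  define S where "S = {line a (w a) |a. a \<in> U \<and> a \<noteq> 0}"
  have w_0: "w 0 = 0"
    using w(2)[of 0 0] by simp
  have ind: "indep2 a (w a)" if "a \<noteq> 0" for a
  proof -
    \<comment> \<open>Either equality would turn \<open>w (w a) = w a + a\<close> into
      \<open>a = 0\<close>.\<close>
    have "w a \<noteq> 0" "w a \<noteq> a"
      using w(3)[of a] that w_0 by auto
    then show ?thesis
      using that by (simp add: indep2_def)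
  qed
  show ?thesis
  proof (intro exI[of _ S] conjI ballI)
    show "S \<subseteq> lines U"
      using w(1) ind line_mem_linesI unfolding S_def by blast
  next
    fix a assume "a \<in> U - {0}"
    then have a: "a \<in> U" "a \<noteq> 0"
      by simp_all
    show "\<exists>!l. l \<in> S \<and> a \<in> l"
    proof (rule ex1I[of _ "line a (w a)"])
      show "line a (w a) \<in> S \<and> a \<in> line a (w a)"
        using a unfolding S_def by (auto simp: line_def)
    next
      fix l assume "l \<in> S \<and> a \<in> l"
      then obtain x where x: "l = line x (w x)" "a \<in> line x (w x)"
        unfolding S_def by blast
      then have "a = 0 \<or> a = x \<or> a = w x \<or> a = x + w x"
        by (simp add: line_def)
      \<comment> \<open>The line is closed under \<open>w\<close>, so it contains the independent
        vectors \<open>a\<close> and \<open>w a\<close>, which determine it.\<close>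
      then have "w a \<in> line x (w x)"
        by (elim disjE) (simp_all add: line_def w w_0 ac_simps)
      then show "l = line a (w a)"
        using line_eqI[OF x(2) _ ind[OF a(2)]] x(1) by simp
    qed
  qed
qed

end

section \<open>The coordinate spaces\<close>

lemma F2_space_design_add:
  assumes m: "even m"
    and "\<exists>D. f2.is_triangle_design (F2_space m) D" and "\<exists>D. f2.is_triangle_design (F2_space n) D"
  shows "\<exists>D. f2.is_triangle_design (F2_space (m + n)) D"
proof -
  \<comment> \<open>The first \<open>m\<close> coordinates will form \<open>A\<close>; the remaining
    ones form \<open>B\<close>, a copy of \<open>F2_space n\<close> moved there by
    \<open>shift\<close>.\<close>
  define p :: "(nat \<Rightarrow> bit) \<Rightarrow> nat \<Rightarrow> bit" where "p x = (\<lambda>i. if i < m then x i else 0)" for x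
  define shift :: "(nat \<Rightarrow> bit) \<Rightarrow> nat \<Rightarrow> bit" where "shift x = (\<lambda>i. if i < m then 0 else x (i - m))" for x
  \<comment> \<open>On each pair of coordinates \<open>2 * k\<close>, \<open>2 * k + 1\<close> this
    is the matrix with rows (0, 1) and (1, 1), a root of X^2 + X + 1: multiplication by a generator
    of F_4.\<close>
  define w :: "(nat \<Rightarrow> bit) \<Rightarrow> nat \<Rightarrow> bit" where "w x = (\<lambda>i. if even i then x (Suc i) else x i + x (i - 1))" for x
  interpret S: f2_splitting f2_scale "F2_space (m + n)" p
  proof unfold_locales
    show "f2.subspace (F2_space (m + n))"
      by (rule subspace_F2_space)
  qed (simp_all add: p_def F2_space_def fun_eq_iff)
  have A: "S.A = F2_space m"
  proof (intro equalityI subsetI)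
    fix x assume "x \<in> S.A"
    then have px: "p x = x"
      by (simp add: S.A_def)
    have "x i = 0" if "i \<ge> m" for i
      using fun_cong[OF px, of i] that by (simp add: p_def)
    then show "x \<in> F2_space m"
      by (simp add: F2_space_def)
  qed (unfold S.A_def, auto simp: p_def F2_space_def fun_eq_iff)
  have B: "S.B = shift ` F2_space n"
  proof (intro equalityI subsetI)
    fix x assume "x \<in> S.B"
    then have xB: "p x = 0" "x \<in> F2_space (m + n)"
      by (simp_all add: S.B_def)
    have x: "x i = 0" if "i < m \<or> i \<ge> m + n" for i
      using fun_cong[OF xB(1), of i] xB(2) that by (auto simp: p_def F2_space_def)
    have "x = shift (\<lambda>i. x (i + m))" "(\<lambda>i. x (i + m)) \<in> F2_space n"
      using x by (auto simp: shift_def F2_space_def)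
    then show "x \<in> shift ` F2_space n"
      by blast
  qed (unfold S.B_def, auto simp: p_def shift_def F2_space_def fun_eq_iff)
  have shift_add: "shift (x + y) = shift x + shift y" for x y
    by (simp add: shift_def fun_eq_iff)
  have shift_inj: "inj shift"
  proof (rule injI, rule ext)
    fix x y i assume "shift x = shift y"
    then have "shift x (i + m) = shift y (i + m)"
      by simp
    then show "x i = y i"
      by (simp add: shift_def)
  qed
  have w_mem: "w x \<in> F2_space m" if x: "x \<in> F2_space m" for x
  proof -
    have "w x i = 0" if i: "i \<ge> m" for i
    proof (cases "even i")
      case True
      then show ?thesis
        using x i by (simp add: w_def F2_space_def)
    next
      case False
      \<comment> \<open>Evenness of \<open>m\<close> enters here: an odd \<open>i\<close> differs
        from \<open>m\<close>, so the bound \<open>m\<close> does not cut a pair of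
        coordinates.\<close>
      then have "i - 1 \<ge> m"
        using m i by (cases "i = m") auto
      then show ?thesis
        using x i False by (simp add: w_def F2_space_def)
    qed
    then show ?thesis
      by (simp add: F2_space_def)
  qed
  have w_add: "w (x + y) = w x + w y" for x y
  proof
    show "w (x + y) i = (w x + w y) i" for i
      by (cases "even i") (simp_all only: w_def plus_fun_apply if_True if_False not_True_eq_False ac_simps simp_thms)
  qed
  have w_w: "w (w x) = w x + x" for x
  proof
    fix i
    show "w (w x) i = (w x + x) i"
    proof (cases "even i")
      case False
      then have "even (i - 1)" "Suc (i - 1) = i"
        by (auto elim: oddE)
      with False show ?thesis
        by (simp only: w_def plus_fun_apply if_True if_False simp_thms)
    qed (simp only: w_def plus_fun_apply if_True if_False simp_thms even_Suc diff_Suc_1)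
  qed
  obtain Sp where Sp: "Sp \<subseteq> f2.lines (F2_space m)" "\<forall>a\<in>F2_space m - {0}. \<exists>!l. l \<in> Sp \<and> a \<in> l"
    using f2.line_spread[of "F2_space m" w, OF subspace_F2_space _ w_add w_w] w_mem by meson
  have dec: "f2.decomposable (f2.lines (F2_space m))" "f2.decomposable (f2.lines (F2_space n))"
    using assms f2.design_iff_decomposable[OF subspace_F2_space] by simp_all
  have "f2.decomposable (f2.lines (F2_space (m + n)))"
  proof (rule S.decomposable_lines_V[of Sp])
    show "f2.decomposable (f2.lines S.A)"
      unfolding A by (rule dec(1))
    show "f2.decomposable (f2.lines S.B)"
      unfolding B by (rule f2.decomposable_lines_image[OF shift_add shift_inj dec(2)])
    show "l \<in> f2.lines S.A" if "l \<in> Sp" for l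
      using subsetD[OF Sp(1) that] unfolding A .
    show "\<exists>!l. l \<in> Sp \<and> a \<in> l" if "a \<in> S.A" "a \<noteq> 0" for a
      using Sp(2) that unfolding A by simp
  qed
  then show ?thesis
    using f2.design_iff_decomposable[OF subspace_F2_space] by simp
qed

theorem theorem6:
  fixes m n :: nat
  assumes "m > 0" and "n > 0" and "even (m * n)"
    and "\<exists>D. f2.is_triangle_design (F2_space m) D"
    and "\<exists>D. f2.is_triangle_design (F2_space n) D"
  shows "\<exists>D. f2.is_triangle_design (F2_space (m + n)) D"
proof (cases "even m")
  case True
  then show ?thesis
    using F2_space_design_add assms(4,5) by blast
next
  case False
  then have "even n"
    using assms(3) by simp
  \<comment> \<open>The even-dimensional space has to be the first summand, so the two are
    exchanged.\<close>
  then show ?thesis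
    using F2_space_design_add[of n m] assms(4,5) by (simp add: add.commute)
qed

end
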